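(* Let $n$ be a positive integer and let $\varphi(n)$ denote Euler's totient function of $n$. Then: (1) $\kappa(\mathcal{RP}(\mathbb Z_n))=n-\varphi(n)$, if $2\varphi(n)+1\ge n$; (2) $\kappa(\mathcal{RP}(\mathbb Z_n))\ge\varphi(n)+1$, if $2\varphi(n)+1<n$; and in this case equality holds when $n=2p$ with $p$ a prime.
   Context: For a group $G$, the reduced power graph $\mathcal{RP}(G)$ is the simple graph with vertex set $G$ in which $u,v$ are adjacent if and only if $\langle v\rangle\subset\langle u\rangle$ or $\langle u\rangle\subset\langle v\rangle$, where $\subset$ means proper inclusion. The connectivity $\kappa(\Gamma)$ of a graph $\Gamma$ is the minimum number of vertices whose removal results in a disconnected or trivial (one-vertex) graph. *)

theory Defs
  imports
    "HOL-Algebra.Elementary_Groups"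
    "HOL-Number_Theory.Totient"
    "Graph_Theory.Graph_Theory"
begin

(* A simple graph is a symmetric loop-free digraph (locale graph of Graph_Theory):
   an edge {u,v} is the pair of arcs (u,v) and (v,u). *)
definition reduced_power_graph :: "('a, 'b) monoid_scheme \<Rightarrow> 'a pair_pre_digraph" where
  "reduced_power_graph G =
    \<lparr> pverts = carrier G,
      parcs = {(u, v). u \<in> carrier G \<and> v \<in> carrier G \<and>
        (generate G {v} \<subset> generate G {u} \<or> generate G {u} \<subset> generate G {v})} \<rparr>"

lemma pair_graph_reduced_power_graph:
  assumes "finite (carrier G)"
  shows "pair_graph (reduced_power_graph G)"
proof -
  have "finite (parcs (reduced_power_graph G))"
    by (rule finite_subset[of _ "carrier G \<times> carrier G"])
      (use assms in \<open>auto simp: reduced_power_graph_def\<close>)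
  then show ?thesis
    using assms
    by unfold_locales
      (auto simp: reduced_power_graph_def symmetric_def sym_def)
qed

(* For finite nonempty graphs. S must be a proper subset of the vertices, because
   Digraph_Component.connected is false for the null graph, which is not to be
   counted as disconnected. *)
definition vertex_connectivity :: "('a, 'b) pre_digraph \<Rightarrow> nat" where
  "vertex_connectivity G =
    (LEAST k. \<exists>S. S \<subset> verts G \<and> finite S \<and> card S = k \<and>
      (\<not> Digraph_Component.connected (G \<restriction> (verts G - S)) \<or> card (verts G - S) = 1))"

(* The minimum is taken over a nonempty set. *)
lemma vertex_connectivity_attained:
  assumes "finite (verts G)" "verts G \<noteq> {}"
  shows "\<exists>S. S \<subset> verts G \<and> finite S \<and> card S = vertex_connectivity G \<and>
    (\<not> Digraph_Component.connected (G \<restriction> (verts G - S)) \<or> card (verts G - S) = 1)"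
proof -
  obtain x where x: "x \<in> verts G"
    using assms(2) by blast
  then have "verts G - (verts G - {x}) = {x}"
    by blast
  with x assms(1) have "\<exists>S. S \<subset> verts G \<and> finite S \<and> card S = card (verts G - {x}) \<and>
      (\<not> Digraph_Component.connected (G \<restriction> (verts G - S)) \<or> card (verts G - S) = 1)"
    by (intro exI[of _ "verts G - {x}"]) auto
  then show ?thesis
    unfolding vertex_connectivity_def by (rule LeastI)
qed

end

theory Submission
  imports Defs "HOL-Algebra.Multiplicative_Group"
begin

text \<open>
  Let \<open>A\<close> be the set of generators of a cyclic group \<open>G\<close> of order \<open>n\<close>. A generator is
  adjacent to every non-generator, so the reduced power graph is the join of the edgeless graph on
  \<open>A\<close> with the graph induced on \<open>carrier G - A\<close>; moreover the identity is adjacent to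
  every other element. The join of two nonempty graphs is connected
  (\<open>connected_induce_join\<close>), hence a set \<open>S\<close> whose deletion leaves a disconnected
  graph or a single vertex either contains all non-generators, or it contains \<open>A\<close> and also, unless it misses only the identity, the identity. This
  gives \<open>\<kappa> \<ge> min (n - \<phi>(n)) (\<phi>(n) + 1)\<close> (\<open>vertex_connectivity_reduced_power_graph_ge\<close>).

  Upper bounds come from independent sets \<open>V \<noteq> {}\<close>: deleting everything else leaves a
  disconnected graph or a single vertex (\<open>vertex_connectivity_le_independent\<close>). Taking
  \<open>V = A\<close> yields \<open>\<kappa> \<le> n - \<phi>(n)\<close>. If the group order is a product of two primes, then a
  nontrivial proper subgroup has prime order, so that no such subgroup properly
  contains another, and \<open>V\<close> may be the set of non-generators other than the identity, if
  there are any; this yields \<open>\<kappa> \<le> \<phi>(n) + 1\<close>. It remains to see that \<open>\<int>/n\<close> has \<open>\<phi>(n)\<close> generators.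
\<close>

section \<open>Connectivity of finite graphs\<close>

lemma connected_induce_join:
  assumes "A \<noteq> {}" "B \<noteq> {}"
    and join: "\<And>a b. a \<in> A \<Longrightarrow> b \<in> B \<Longrightarrow> (a, b) \<in> parcs H"
  shows "Digraph_Component.connected (with_proj H \<restriction> (A \<union> B))"
proof -
  define R where "R = (arcs_ends (with_proj H \<restriction> (A \<union> B)))\<^sup>s"
  have R: "(a, b) \<in> R" "(b, a) \<in> R" if "a \<in> A" "b \<in> B" for a b
    using join[OF that] that
    by (auto simp: R_def symcl_def arcs_ends_conv induce_subgraph_def image_iff)
  obtain a b where ab: "a \<in> A" "b \<in> B"
    using assms by blast
  \<comment> \<open>Any two vertices are joined by a walk through \<open>a\<close>.\<close>
  have A: "(x, a) \<in> rtrancl_on (A \<union> B) R \<and> (a, x) \<in> rtrancl_on (A \<union> B) R" if "x \<in> A \<union> B" for x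
  proof (cases "x \<in> B")
    case True
    then show ?thesis
      using R[OF ab(1) True] ab
      by (auto intro: rtrancl_on_into_rtrancl_on)
  next
    case False
    then have "x \<in> A"
      using that by blast
    then show ?thesis
      using R[OF ab] R[OF \<open>x \<in> A\<close> ab(2)] ab that
      by (meson UnI1 UnI2 rtrancl_on_into_rtrancl_on rtrancl_on_refl)
  qed
  then have "(x, y) \<in> rtrancl_on (A \<union> B) R" if "x \<in> A \<union> B" "y \<in> A \<union> B" for x y
    using that by (meson rtrancl_on_trans)
  then show ?thesis
    using ab by (auto simp: connected_conv R_def)
qed

lemma not_connected_induce_independent:
  assumes "\<And>u v. u \<in> V \<Longrightarrow> v \<in> V \<Longrightarrow> (u, v) \<notin> parcs H"
    and "card V \<noteq> 1"
  shows "\<not> Digraph_Component.connected (with_proj H \<restriction> V)"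
proof
  assume conn: "Digraph_Component.connected (with_proj H \<restriction> V)"
  have no_arcs: "(arcs_ends (with_proj H \<restriction> V))\<^sup>s = {}"
    using assms(1) by (auto simp: symcl_def arcs_ends_conv induce_subgraph_def)
  have "u = v" if "(u, v) \<in> rtrancl_on V {}" for u v
    using that by induction auto
  then have "u = v" if "u \<in> V" "v \<in> V" for u v
    using conn that by (auto simp: connected_conv no_arcs)
  moreover obtain u where "u \<in> V"
    using conn by (auto simp: connected_conv)
  ultimately have "V = {u}"
    by blast
  then show False
    using assms(2) by simp
qed

lemma vertex_connectivity_le_independent:
  assumes "finite (pverts H)" "V \<subseteq> pverts H" "V \<noteq> {}"
    and "\<And>u v. u \<in> V \<Longrightarrow> v \<in> V \<Longrightarrow> (u, v) \<notin> parcs H"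
  shows "vertex_connectivity (with_proj H) \<le> card (pverts H - V)"
proof -
  have "pverts H - (pverts H - V) = V"
    using assms(2) by blast
  then have "\<not> Digraph_Component.connected (with_proj H \<restriction> (pverts H - (pverts H - V))) \<or>
      card (pverts H - (pverts H - V)) = 1"
    using not_connected_induce_independent[of V H] assms(4) by auto
  then show ?thesis
    unfolding vertex_connectivity_def
    using assms(1-3) by (intro Least_le exI[of _ "pverts H - V"]) auto
qed

section \<open>Generators and the reduced power graph of a finite group\<close>

text \<open>The elements that generate the whole group; the set is empty unless the group is cyclic.\<close>
definition group_generators :: "('a, 'b) monoid_scheme \<Rightarrow> 'a set" where
  "group_generators G = {u \<in> carrier G. generate G {u} = carrier G}"

lemma pverts_reduced_power_graph [simp]: "pverts (reduced_power_graph G) = carrier G"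
  by (simp add: reduced_power_graph_def)

context group
begin

lemma generator_adjacent_nongenerator:
  assumes "u \<in> group_generators G" "v \<in> carrier G - group_generators G"
  shows "(u, v) \<in> parcs (reduced_power_graph G)"
  using assms generate_in_carrier[of "{v}"]
  by (auto simp: group_generators_def reduced_power_graph_def)

lemma one_adjacent:
  assumes "v \<in> carrier G" "v \<noteq> \<one>"
  shows "(\<one>, v) \<in> parcs (reduced_power_graph G)"
proof -
  have "generate G {\<one>} = {\<one>}"
    by (simp add: generate_one)
  moreover have "v \<in> generate G {v}" "\<one> \<in> generate G {v}"
    by (auto intro: generate.incl generate.one)
  ultimately show ?thesis
    using assms by (auto simp: reduced_power_graph_def)
qed

lemma vertex_connectivity_reduced_power_graph_ge:
  assumes fin: "finite (carrier G)" and gens: "group_generators G \<noteq> {}"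
  shows "vertex_connectivity (with_proj (reduced_power_graph G))
    \<ge> min (card (carrier G - group_generators G)) (card (group_generators G) + 1)"
proof -
  let ?A = "group_generators G" and ?H = "reduced_power_graph G"
  have A: "?A \<subseteq> carrier G"
    by (auto simp: group_generators_def)
  obtain S where S: "S \<subset> carrier G" "finite S"
      and card_S: "card S = vertex_connectivity (with_proj ?H)"
      and sep: "\<not> Digraph_Component.connected (with_proj ?H \<restriction> (carrier G - S))
        \<or> card (carrier G - S) = 1"
    using vertex_connectivity_attained[of "with_proj ?H"] fin by auto
  \<comment> \<open>What remains after deleting \<open>S\<close> is not a join of two nonempty graphs.\<close>
  have no_join: False
    if "carrier G - S = B \<union> C" "B \<noteq> {}" "C \<noteq> {}" "B \<inter> C = {}"
      "\<And>b c. b \<in> B \<Longrightarrow> c \<in> C \<Longrightarrow> (b, c) \<in> parcs ?H" for B C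
  proof -
    have "card (B \<union> C) \<noteq> 1"
      using that(2-4) by (auto simp: card_1_singleton_iff Un_singleton_iff)
    moreover have "Digraph_Component.connected (with_proj ?H \<restriction> (B \<union> C))"
      using that by (intro connected_induce_join) auto
    ultimately show False
      using sep that(1) by simp
  qed
  show ?thesis
  proof (cases "carrier G - ?A \<subseteq> S")
    case True
    then show ?thesis
      using card_mono[OF S(2) True] card_S by linarith
  next
    case False
    then obtain v where v: "v \<in> carrier G - ?A" "v \<notin> S"
      by blast
    have AS: "?A \<subseteq> S"
    proof (rule ccontr)
      assume "\<not> ?A \<subseteq> S"
      then show False
        using A v generator_adjacent_nongenerator
        by (intro no_join[of "?A - S" "carrier G - ?A - S"]) auto
    qed
    show ?thesis
    proof (cases "\<one> \<in> S")
      case True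
      have "\<one> \<notin> ?A"
      proof
        assume "\<one> \<in> ?A"
        then have "carrier G = {\<one>}"
          by (auto simp: group_generators_def generate_one)
        then show False
          using v \<open>\<one> \<in> ?A\<close> by auto
      qed
      then have "card (insert \<one> ?A) = card ?A + 1"
        using finite_subset[OF A fin] by simp
      moreover have "card (insert \<one> ?A) \<le> card S"
        using AS True S(2) by (intro card_mono) auto
      ultimately show ?thesis
        using card_S by linarith
    next
      case False
      have "carrier G - S - {\<one>} = {}"
      proof (rule ccontr)
        assume "carrier G - S - {\<one>} \<noteq> {}"
        then show False
          using False one_adjacent by (intro no_join[of "{\<one>}" "carrier G - S - {\<one>}"]) auto
      qed
      then have "S = carrier G - {\<one>}"
        using S(1) False by blast
      then have "card S = card (carrier G) - 1"
        using fin by simp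
      moreover have "card (carrier G - ?A) = card (carrier G) - card ?A" "card ?A \<ge> 1"
        using A fin gens finite_subset[OF A fin]
        by (auto simp: card_Diff_subset Suc_le_eq card_gt_0_iff)
      \<comment> \<open>\<open>S\<close> misses only the identity, so it is at least as large as the set of non-generators,
        which misses at least one generator.\<close>
      ultimately show ?thesis
        using card_S by linarith
    qed
  qed
qed

lemma vertex_connectivity_reduced_power_graph_le_nongenerators:
  assumes "finite (carrier G)" "group_generators G \<noteq> {}"
  shows "vertex_connectivity (with_proj (reduced_power_graph G))
    \<le> card (carrier G - group_generators G)"
proof -
  have "vertex_connectivity (with_proj (reduced_power_graph G))
      \<le> card (pverts (reduced_power_graph G) - group_generators G)"
    using assms by (intro vertex_connectivity_le_independent)
      (auto simp: group_generators_def reduced_power_graph_def)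
  then show ?thesis
    by simp
qed

lemma card_generate_dvd_card_generate:
  assumes "finite (carrier G)" "u \<in> carrier G" "v \<in> carrier G" "generate G {u} \<subseteq> generate G {v}"
  shows "card (generate G {u}) dvd card (generate G {v})"
proof -
  have "u \<in> generate G {v}"
    using assms(4) by (auto intro: generate.incl)
  then obtain k :: nat where "u = v [^] k"
    using generate_pow_on_finite_carrier[OF assms(1,3)] by blast
  then have "u [^] ord v = \<one>"
    using assms(3) by (metis nat_pow_one nat_pow_pow mult.commute pow_ord_eq_1)
  then show ?thesis
    using assms(2,3) by (simp add: pow_eq_id flip: generate_pow_card)
qed

text \<open>In a group of order \<open>p q\<close>, every nontrivial proper cyclic subgroup has prime order.\<close>
lemma prime_card_generate_of_order_eq_prime_mult_prime:
  assumes "card (carrier G) = p * q" "prime p" "prime q"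
    and v: "v \<in> carrier G - group_generators G - {\<one>}"
  shows "prime (card (generate G {v}))"
proof -
  have "p * q > 0"
    using assms(2,3) by (simp add: prime_gt_0_nat)
  then have fin: "finite (carrier G)"
    using assms(1) card_gt_0_iff by metis
  have sub: "generate G {v} \<subset> carrier G"
    using v generate_in_carrier[of "{v}"] by (auto simp: group_generators_def)
  have "card (generate G {v}) dvd p * q"
    using v fin ord_dvd_group_order[of v] assms(1) by (simp add: generate_pow_card order_def)
  then obtain x y where xy: "card (generate G {v}) = x * y" "x dvd p" "y dvd q"
    using division_decomp by blast
  have "card (generate G {v}) \<noteq> p * q"
    using psubset_card_mono[OF fin sub] assms(1) by simp
  moreover have "card (generate G {v}) \<noteq> 1"
    using v ord_eq_1[of v] by (simp add: generate_pow_card)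
  moreover have "x = 1 \<or> x = p" "y = 1 \<or> y = q"
    using xy assms(2,3) by (auto simp: prime_nat_iff)
  ultimately show ?thesis
    using xy(1) assms(2,3) by auto
qed

lemma vertex_connectivity_reduced_power_graph_le_of_order_eq_prime_mult_prime:
  assumes card_G: "card (carrier G) = p * q" "prime p" "prime q"
    and nonempty: "carrier G - group_generators G - {\<one>} \<noteq> {}"
  shows "vertex_connectivity (with_proj (reduced_power_graph G)) \<le> card (group_generators G) + 1"
proof -
  let ?H = "reduced_power_graph G" and ?V = "carrier G - group_generators G - {\<one>}"
  have "p * q > 0"
    using assms(2,3) by (simp add: prime_gt_0_nat)
  then have fin: "finite (carrier G)"
    using assms(1) card_gt_0_iff by metis
  have not_nested: "\<not> generate G {u} \<subset> generate G {v}" if "u \<in> ?V" "v \<in> ?V" for u v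
  proof
    assume sub: "generate G {u} \<subset> generate G {v}"
    have "finite (generate G {v})"
      using that(2) fin generate_in_carrier[of "{v}"] by (auto intro: finite_subset)
    then have "card (generate G {u}) < card (generate G {v})"
      using sub by (rule psubset_card_mono)
    moreover have "card (generate G {u}) dvd card (generate G {v})"
      using that fin sub by (intro card_generate_dvd_card_generate) auto
    then have "card (generate G {u}) = card (generate G {v})"
      using that[THEN prime_card_generate_of_order_eq_prime_mult_prime[OF card_G]]
      by (intro primes_dvd_imp_eq)
    ultimately show False
      by simp
  qed
  have "vertex_connectivity (with_proj ?H) \<le> card (pverts ?H - ?V)"
    using fin nonempty not_nested
    by (intro vertex_connectivity_le_independent) (auto simp: reduced_power_graph_def)
  also have "\<dots> \<le> card (insert \<one> (group_generators G))"
    using fin by (intro card_mono) (auto simp: group_generators_def)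
  also have "\<dots> \<le> card (group_generators G) + 1"
    using card_insert_le_m1[of "card (group_generators G) + 1" "group_generators G" \<one>] by simp
  finally show ?thesis .
qed

end

section \<open>Generators of the integers modulo n\<close>

lemma group_generators_integer_mod_group:
  assumes "n > 0"
  shows "group_generators (integer_mod_group n) = {u \<in> {0..<int n}. coprime u (int n)}"
proof -
  interpret group "integer_mod_group n"
    by simp
  have carr: "carrier (integer_mod_group n) = {0..<int n}"
    using assms by (simp add: carrier_integer_mod_group)
  have "generate (integer_mod_group n) {u} = {0..<int n} \<longleftrightarrow> coprime u (int n)"
    if u: "u \<in> {0..<int n}" for u
  proof -
    have gen: "generate (integer_mod_group n) {u} = range (\<lambda>k. k * u mod int n)"
      using u generate_pow[of u] by (auto simp: carr int_pow_integer_mod_group)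
    show ?thesis
    proof
      assume "generate (integer_mod_group n) {u} = {0..<int n}"
      moreover have "1 mod int n \<in> {0..<int n}"
        using assms by simp
      ultimately obtain k where "1 mod int n = k * u mod int n"
        using gen by blast
      then have "[u * k = 1] (mod int n)"
        by (simp add: cong_def mult.commute)
      then show "coprime u (int n)"
        by (metis coprime_iff_invertible_int)
    next
      assume "coprime u (int n)"
      then obtain k where k: "[u * k = 1] (mod int n)"
        by (metis coprime_iff_invertible_int)
      have "x \<in> range (\<lambda>k. k * u mod int n)" if "x \<in> {0..<int n}" for x
      proof -
        have "[x * k * u = x] (mod int n)"
          using cong_scalar_left[OF k, of x] by (simp add: ac_simps)
        then show ?thesis
          using that by (intro range_eqI[of _ _ "x * k"]) (simp add: cong_def)
      qed
      then show "generate (integer_mod_group n) {u} = {0..<int n}"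
        using assms by (auto simp: gen)
    qed
  qed
  then show ?thesis
    by (auto simp: group_generators_def carr)
qed

lemma card_group_generators_integer_mod_group:
  assumes "n > 0"
  shows "card (group_generators (integer_mod_group n)) = totient n"
proof (cases "n = 1")
  case True
  then have "group_generators (integer_mod_group n) = {0}"
    by (auto simp: group_generators_integer_mod_group)
  then show ?thesis
    using True by simp
next
  case False
  have "group_generators (integer_mod_group n) = int ` totatives n"
  proof (intro equalityI subsetI)
    fix u assume "u \<in> group_generators (integer_mod_group n)"
    then have u: "0 \<le> u" "u < int n" "coprime u (int n)"
      using assms by (auto simp: group_generators_integer_mod_group)
    moreover from u False have "u \<noteq> 0"
      by auto
    ultimately have "u = int (nat u)" "nat u \<in> totatives n"
      by (auto simp: totatives_def simp flip: coprime_int_iff)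
    then show "u \<in> int ` totatives n"
      by blast
  next
    fix u assume "u \<in> int ` totatives n"
    then obtain k where k: "u = int k" "k \<in> totatives n"
      by blast
    then have "k < n"
      using totatives_less[OF k(2)] False assms by linarith
    with k show "u \<in> group_generators (integer_mod_group n)"
      by (simp add: group_generators_integer_mod_group[OF assms] totatives_def)
  qed
  then show ?thesis
    by (simp add: card_image totient_def)
qed

section \<open>The connectivity of the reduced power graph of a finite cyclic group\<close>

theorem proposition5p1:
  fixes n :: nat
  assumes "n > 0"
  shows
    "(2 * totient n + 1 \<ge> n \<longrightarrow>
        vertex_connectivity (with_proj (reduced_power_graph (integer_mod_group n))) = n - totient n) \<and>
     (2 * totient n + 1 < n \<longrightarrow>
        vertex_connectivity (with_proj (reduced_power_graph (integer_mod_group n))) \<ge> totient n + 1 \<and>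
        ((\<exists>p::nat. prime p \<and> n = 2 * p) \<longrightarrow>
          vertex_connectivity (with_proj (reduced_power_graph (integer_mod_group n))) = totient n + 1))"
proof -
  let ?G = "integer_mod_group n"
  let ?\<kappa> = "vertex_connectivity (with_proj (reduced_power_graph ?G))"
  interpret group ?G
    by simp
  have carr: "carrier ?G = {0..<int n}"
    using assms by (simp add: carrier_integer_mod_group)
  then have fin: "finite (carrier ?G)" and card_carrier: "card (carrier ?G) = n"
    by simp_all
  have card_gens: "card (group_generators ?G) = totient n"
    using assms by (rule card_group_generators_integer_mod_group)
  then have gens: "group_generators ?G \<noteq> {}"
    using assms by (metis card.empty less_irrefl totient_gt_0_iff)
  have gens_carrier: "group_generators ?G \<subseteq> carrier ?G"
    by (auto simp: group_generators_def)
  have card_nongens: "card (carrier ?G - group_generators ?G) = n - totient n"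
    using card_Diff_subset[OF finite_subset[OF gens_carrier fin] gens_carrier]
    by (simp add: card_carrier card_gens)
  have lower: "?\<kappa> \<ge> min (n - totient n) (totient n + 1)"
    using vertex_connectivity_reduced_power_graph_ge[OF fin gens]
    by (simp only: card_nongens card_gens)
  have upper: "?\<kappa> \<le> n - totient n"
    using vertex_connectivity_reduced_power_graph_le_nongenerators[OF fin gens]
    by (simp only: card_nongens)
  have upper_2p: "?\<kappa> \<le> totient n + 1" if "2 * totient n + 1 < n" "prime p" "n = 2 * p" for p
  proof -
    have "carrier ?G - group_generators ?G - {\<one>\<^bsub>?G\<^esub>} \<noteq> {}"
    proof
      assume "carrier ?G - group_generators ?G - {\<one>\<^bsub>?G\<^esub>} = {}"
      then have "carrier ?G - group_generators ?G \<subseteq> {\<one>\<^bsub>?G\<^esub>}"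
        by blast
      then have "card (carrier ?G - group_generators ?G) \<le> card {\<one>\<^bsub>?G\<^esub>}"
        by (intro card_mono) simp_all
      then have "n - totient n \<le> 1"
        unfolding card_nongens by simp
      moreover have "totient n > 0"
        using assms by simp
      ultimately show False
        using that(1) by linarith
    qed
    moreover have "card (carrier ?G) = 2 * p"
      using card_carrier that(3) by simp
    ultimately have "?\<kappa> \<le> card (group_generators ?G) + 1"
      using two_is_prime_nat that(2)
      by (intro vertex_connectivity_reduced_power_graph_le_of_order_eq_prime_mult_prime)
    then show ?thesis
      by (simp only: card_gens)
  qed
  show ?thesis
  proof (intro conjI impI)
    assume "n \<le> 2 * totient n + 1"
    then show "?\<kappa> = n - totient n"
      using lower upper by linarith
  next
    assume "2 * totient n + 1 < n"
    then show "totient n + 1 \<le> ?\<kappa>"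
      using lower by linarith
  next
    assume less: "2 * totient n + 1 < n" and "\<exists>p. prime p \<and> n = 2 * p"
    then have "?\<kappa> \<le> totient n + 1"
      using upper_2p by blast
    then show "?\<kappa> = totient n + 1"
      using lower less by linarith
  qed
qed

end
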